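(* Let $m,n\ge 1$, let $A:\mathbb{R}^m\times\mathbb{R}\to\mathbb{S}^n$ and $B:\mathbb{R}^m\to\mathbb{S}^n$, and consider the optimization problem $$\text{(P)}\qquad \underset{x\in\mathbb{R}^m,\ y\in\mathbb{R}}{\text{minimize}}\ \ y\quad\text{subject to}\quad A(x,y)\succeq 0,\ \ B(x)\succeq 0.$$ Assume: (a) for every feasible $y\in\mathbb{R}$, the map $A(\cdot,y):\mathbb{R}^m\to\mathbb{S}^n$ is differentiable and (matrix) concave; and $B:\mathbb{R}^m\to\mathbb{S}^n$ is differentiable and (matrix) concave; (b) for every feasible $x\in\mathbb{R}^m$, the map $A(x,\cdot):\mathbb{R}\to\mathbb{S}^n$ is differentiable and strictly increasing in the Loewner order, i.e. $y>y'$ implies $A(x,y)\succ A(x,y')$. Define $$\varphi(x)=\inf\{y\in\mathbb{R}\mid A(x,y)\succeq0,\ B(x)\succeq0\}\qquad(x\in\mathbb{R}^m),$$ with the convention $\inf\emptyset=+\infty$, and assume that $\varphi$ takes values in $(-\infty,\infty]$, i.e. $\varphi(x)>-\infty$ for every $x\in\mathbb{R}^m$. Then $\varphi:\mathbb{R}^m\to(-\infty,\infty]$ is quasiconvex.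
   Context: $\mathbb{S}^n$ is the set of real symmetric $n\times n$ matrices. $X\succeq0$ (resp. $X\succ0$) means that $X$ is symmetric positive semidefinite (resp. positive definite); $X\succeq Y$ means $X-Y\succeq0$, and $X\succ Y$ means $X-Y\succ0$. A pair $(x,y)$ is feasible for (P) if $A(x,y)\succeq0$ and $B(x)\succeq0$. A number $y\in\mathbb{R}$ is called feasible if $(x,y)$ is feasible for some $x\in\mathbb{R}^m$, and a vector $x\in\mathbb{R}^m$ is called feasible if $(x,y)$ is feasible for some $y\in\mathbb{R}$. Matrix convexity and concavity: $F:\mathbb{R}^m\to\mathbb{S}^n$ is convex if $\lambda F(x)+(1-\lambda)F(x')\succeq F(\lambda x+(1-\lambda)x')$ for all $x,x'\in\mathbb{R}^m$ and $\lambda\in[0,1]$; $F$ is concave if $-F$ is convex. Quasiconvexity: a function $f:\mathbb{R}^m\to(-\infty,\infty]$ is quasiconvex if the sublevel set $\{x\in\mathbb{R}^m\mid f(x)\le\alpha\}$ is convex for every $\alpha\in\mathbb{R}$. *)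

theory Defs
  imports "HOL-Analysis.Analysis"
begin

definition sym_mats :: "(real ^ 'n ^ 'n) set"
  where "sym_mats = {X. transpose X = X}"

definition psd :: "real ^ 'n ^ 'n \<Rightarrow> bool"
  where "psd X \<longleftrightarrow> X \<in> sym_mats \<and> (\<forall>v. 0 \<le> v \<bullet> (X *v v))"

definition pd :: "real ^ 'n ^ 'n \<Rightarrow> bool"
  where "pd X \<longleftrightarrow> X \<in> sym_mats \<and> (\<forall>v. v \<noteq> 0 \<longrightarrow> 0 < v \<bullet> (X *v v))"

definition loewner_ge :: "real ^ 'n ^ 'n \<Rightarrow> real ^ 'n ^ 'n \<Rightarrow> bool"
  where "loewner_ge X Y \<longleftrightarrow> psd (X - Y)"

definition loewner_gt :: "real ^ 'n ^ 'n \<Rightarrow> real ^ 'n ^ 'n \<Rightarrow> bool"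
  where "loewner_gt X Y \<longleftrightarrow> pd (X - Y)"

definition matrix_convex :: "('a::real_vector \<Rightarrow> real ^ 'n ^ 'n) \<Rightarrow> bool"
  where "matrix_convex F \<longleftrightarrow>
    (\<forall>x x'. \<forall>t\<in>{0..1}.
      loewner_ge (t *\<^sub>R F x + (1 - t) *\<^sub>R F x') (F (t *\<^sub>R x + (1 - t) *\<^sub>R x')))"

definition matrix_concave :: "('a::real_vector \<Rightarrow> real ^ 'n ^ 'n) \<Rightarrow> bool"
  where "matrix_concave F \<longleftrightarrow> matrix_convex (\<lambda>x. - F x)"

definition loewner_strict_increasing :: "(real \<Rightarrow> real ^ 'n ^ 'n) \<Rightarrow> bool"
  where "loewner_strict_increasing F \<longleftrightarrow> (\<forall>y y'. y > y' \<longrightarrow> loewner_gt (F y) (F y'))"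

(* The range condition expresses that f takes values in (-\<infinity>, \<infinity>]. *)
definition quasiconvex :: "('a::real_vector \<Rightarrow> ereal) \<Rightarrow> bool"
  where "quasiconvex f \<longleftrightarrow>
    (\<forall>x. f x > - \<infinity>) \<and> (\<forall>\<alpha>::real. convex {x. f x \<le> ereal \<alpha>})"

definition feasible ::
    "('a \<Rightarrow> real \<Rightarrow> real ^ 'n ^ 'n) \<Rightarrow> ('a \<Rightarrow> real ^ 'n ^ 'n) \<Rightarrow> 'a \<Rightarrow> real \<Rightarrow> bool"
  where "feasible A B x y \<longleftrightarrow> psd (A x y) \<and> psd (B x)"

definition feasible_y ::
    "('a \<Rightarrow> real \<Rightarrow> real ^ 'n ^ 'n) \<Rightarrow> ('a \<Rightarrow> real ^ 'n ^ 'n) \<Rightarrow> real \<Rightarrow> bool"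
  where "feasible_y A B y \<longleftrightarrow> (\<exists>x. feasible A B x y)"

definition feasible_x ::
    "('a \<Rightarrow> real \<Rightarrow> real ^ 'n ^ 'n) \<Rightarrow> ('a \<Rightarrow> real ^ 'n ^ 'n) \<Rightarrow> 'a \<Rightarrow> bool"
  where "feasible_x A B x \<longleftrightarrow> (\<exists>y. feasible A B x y)"

(* The infimum is taken in ereal, where Inf {} = \<infinity>. *)
definition opt_value ::
    "('a \<Rightarrow> real \<Rightarrow> real ^ 'n ^ 'n) \<Rightarrow> ('a \<Rightarrow> real ^ 'n ^ 'n) \<Rightarrow> 'a \<Rightarrow> ereal"
  where "opt_value A B x = Inf {ereal y |y. psd (A x y) \<and> psd (B x)}"

end

theory Submission
  imports Defs
begin

text \<open>If \<open>\<phi> x \<le> \<alpha>\<close>, strict monotonicity of \<open>A x\<close> makes every \<open>y > \<alpha>\<close> feasible for \<open>x\<close>, although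
  \<open>y = \<alpha>\<close> itself may a priori not be. For such \<open>y\<close>, concavity of \<open>A(\<cdot>, y)\<close> and \<open>B\<close> makes the set of
  \<open>x\<close> with \<open>(x, y)\<close> feasible convex, so that \<open>\<phi> \<le> y\<close> on the whole segment; let \<open>y\<close> decrease to \<open>\<alpha>\<close>.\<close>

lemma psd_add:
  assumes "psd X" "psd Y"
  shows "psd (X + Y)"
  using assms
  by (auto simp: psd_def sym_mats_def transpose_def vec_eq_iff
      matrix_vector_mult_add_rdistrib inner_add_right)

lemma psd_scaleR:
  assumes "psd X" "0 \<le> c"
  shows "psd (c *\<^sub>R X)"
  using assms
  by (auto simp: psd_def sym_mats_def transpose_def vec_eq_iff
      simp flip: scaleR_matrix_vector_assoc)

lemma pd_imp_psd: "pd X \<Longrightarrow> psd X"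
  unfolding pd_def psd_def by (metis inner_zero_left less_eq_real_def)

lemma psd_if_loewner_ge:
  assumes "loewner_ge X Y" "psd Y"
  shows "psd X"
  using psd_add[of "X - Y" Y] assms by (simp add: loewner_ge_def)

lemma loewner_ge_if_loewner_gt: "loewner_gt X Y \<Longrightarrow> loewner_ge X Y"
  by (simp add: loewner_gt_def loewner_ge_def pd_imp_psd)

text \<open>Concavity places the value of \<open>F\<close> at a convex combination above the same
  combination of its values. The latter is \<open>psd\<close> because such matrices form a convex
  cone, and \<open>psd\<close> passes upward in the Loewner order.\<close>

lemma convex_psd_superlevel:
  assumes "matrix_concave F"
  shows "convex {x. psd (F x)}"
  unfolding convex_alt
proof (intro ballI allI impI, elim conjE)
  fix x z and u :: real
  assume x: "x \<in> {x. psd (F x)}" and z: "z \<in> {x. psd (F x)}" and u: "0 \<le> u" "u \<le> 1"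
  \<comment> \<open>The point \<open>z\<close> comes first, with weight \<open>u\<close>, to match
    the form of segment in \<open>convex_alt\<close>.\<close>
  have "loewner_ge (u *\<^sub>R - F z + (1 - u) *\<^sub>R - F x) (- F (u *\<^sub>R z + (1 - u) *\<^sub>R x))"
    using assms u unfolding matrix_concave_def matrix_convex_def by auto
  then have "loewner_ge (F (u *\<^sub>R z + (1 - u) *\<^sub>R x)) (u *\<^sub>R F z + (1 - u) *\<^sub>R F x)"
    by (simp add: loewner_ge_def algebra_simps)
  moreover have "psd (u *\<^sub>R F z + (1 - u) *\<^sub>R F x)"
    using x z u by (intro psd_add psd_scaleR) auto
  ultimately show "(1 - u) *\<^sub>R x + u *\<^sub>R z \<in> {x. psd (F x)}"
    by (auto intro: psd_if_loewner_ge simp: add.commute)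
qed

text \<open>An infimum strictly below \<open>y\<close> is undercut by some feasible
  \<open>y' < y\<close>, attained or not. This \<open>y'\<close> also witnesses
  \<open>feasible_x A B x\<close>, so \<open>mono\<close> applies and carries feasibility from
  \<open>y'\<close> up to \<open>y\<close>.\<close>

lemma feasible_above_opt_value:
  assumes mono: "feasible_x A B x \<Longrightarrow> loewner_strict_increasing (A x)"
    and less: "opt_value A B x < ereal y"
  shows "feasible A B x y"
proof -
  obtain y' where y': "feasible A B x y'" "y' < y"
    using less unfolding opt_value_def Inf_less_iff feasible_def by auto
  then have "loewner_gt (A x y) (A x y')"
    using mono unfolding feasible_x_def loewner_strict_increasing_def by blast
  then show ?thesis
    using y' psd_if_loewner_ge loewner_ge_if_loewner_gt unfolding feasible_def by blast
qed

lemma opt_value_le_if_feasible: "feasible A B x y \<Longrightarrow> opt_value A B x \<le> ereal y"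
  unfolding opt_value_def feasible_def by (auto intro: Inf_lower)

theorem theorem5p1:
  fixes A :: "real ^ 'm \<Rightarrow> real \<Rightarrow> real ^ 'n ^ 'n"
    and B :: "real ^ 'm \<Rightarrow> real ^ 'n ^ 'n"
  assumes A_sym: "\<And>x y. A x y \<in> sym_mats"
    and B_sym: "\<And>x. B x \<in> sym_mats"
    and A_x: "\<And>y. feasible_y A B y \<Longrightarrow>
      (\<lambda>x. A x y) differentiable_on UNIV \<and> matrix_concave (\<lambda>x. A x y)"
    and B_x: "B differentiable_on UNIV \<and> matrix_concave B"
    and A_y: "\<And>x. feasible_x A B x \<Longrightarrow>
      (\<lambda>y. A x y) differentiable_on UNIV \<and> loewner_strict_increasing (\<lambda>y. A x y)"
    and finite_below: "\<And>x. opt_value A B x > - \<infinity>"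
  shows "quasiconvex (opt_value A B)"
  unfolding quasiconvex_def
proof (intro conjI allI)
  show "opt_value A B x > - \<infinity>" for x
    by (fact finite_below)
next
  fix \<alpha> :: real
  show "convex {x. opt_value A B x \<le> ereal \<alpha>}"
    unfolding convex_def
  proof (intro ballI allI impI)
    fix x z and u v :: real
    assume x: "x \<in> {x. opt_value A B x \<le> ereal \<alpha>}" and z: "z \<in> {x. opt_value A B x \<le> ereal \<alpha>}"
      and uv: "0 \<le> u" "0 \<le> v" "u + v = 1"
    have "opt_value A B (u *\<^sub>R x + v *\<^sub>R z) \<le> ereal y" if "\<alpha> < y" for y
    proof -
      have feas: "feasible A B x y" "feasible A B z y"
        using x z that A_y by (auto intro!: feasible_above_opt_value elim: le_less_trans)
      \<comment> \<open>Concavity is assumed only for feasible values of \<open>y\<close>; an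
        endpoint of the segment is the witness here.\<close>
      then have "matrix_concave (\<lambda>x. A x y)"
        using A_x unfolding feasible_y_def by blast
      then have "convex ({x. psd (A x y)} \<inter> {x. psd (B x)})"
        using B_x by (intro convex_Int convex_psd_superlevel) auto
      from convexD[OF this _ _ uv, of x z] feas have "feasible A B (u *\<^sub>R x + v *\<^sub>R z) y"
        unfolding feasible_def by auto
      then show ?thesis
        by (rule opt_value_le_if_feasible)
    qed
    then show "u *\<^sub>R x + v *\<^sub>R z \<in> {x. opt_value A B x \<le> ereal \<alpha>}"
      \<comment> \<open>Were the value above \<alpha>, a real \<open>y\<close> strictly between the
        two would contradict the bound just shown.\<close>
      by (metis ereal_dense2 less_ereal.simps(1) linorder_not_le mem_Collect_eq)
  qed
qed

end
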